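(* There exist random variables $S, X_1, X_2$ with finite alphabets (jointly distributed on a common probability space) and a function $f:\mathcal{S}\to\mathcal{S}'$ from the support $\mathcal{S}$ of $S$ to a finite set $\mathcal{S}'$ such that the following three properties all hold: 1. $S$ and $X_1$ are conditionally independent given $f(S)$; 2. $(X_1\leftarrow f(S)) \prec (X_2\leftarrow f(S))$; 3. $(X_1\leftarrow S) \not\preceq (X_2\leftarrow S)$.
   Context: A channel with finite input alphabet $\mathcal{I}$ and finite output alphabet $\mathcal{O}$ is a column-stochastic matrix $\kappa=(\kappa_{x,s})_{x\in\mathcal{O},s\in\mathcal{I}}$, that is, it has nonnegative entries and $\sum_{x}\kappa_{x,s}=1$ for every $s\in\mathcal{I}$. The product of channels (composition) is matrix multiplication. For two channels $\kappa_1,\kappa_2$ with the same input alphabet (and possibly different output alphabets), write $\kappa_1\preceq\kappa_2$ (Blackwell order) if there is a column-stochastic matrix $\lambda$ with $\kappa_1=\lambda\cdot\kappa_2$ (i.e. $\kappa_1$ is a garbling of $\kappa_2$). Write $\kappa_1\prec\kappa_2$ if $\kappa_1\preceq\kappa_2$ holds and $\kappa_2\preceq\kappa_1$ does not hold. For jointly distributed finite-valued random variables $T, X$, the notation $X\leftarrow T$ denotes the channel whose input alphabet is the support of $T$ (the set of values $t$ with $\Pr(T=t)>0$), whose output alphabet is that of $X$, and whose entries are the conditional probabilities $P_{X|T}(x|t)$. *)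

theory Defs
  imports "HOL-Probability.Probability"
begin

text \<open>
  A matrix with rows indexed by \<open>outputs\<close> and columns indexed by \<open>inputs\<close>. Alphabets are sets
  rather than types because the input alphabet of the channel between two random variables is the
  support of one of them. Entries outside \<open>outputs \<times> inputs\<close> are irrelevant.
\<close>

record ('s, 'x) channel =
  inputs :: "'s set"
  outputs :: "'x set"
  entry :: "'x \<Rightarrow> 's \<Rightarrow> real"

definition stochastic :: "('s, 'x) channel \<Rightarrow> bool" where
  "stochastic \<kappa> \<longleftrightarrow>
     finite (inputs \<kappa>) \<and> finite (outputs \<kappa>) \<and>
     (\<forall>x\<in>outputs \<kappa>. \<forall>s\<in>inputs \<kappa>. 0 \<le> entry \<kappa> x s) \<and>
     (\<forall>s\<in>inputs \<kappa>. (\<Sum>x\<in>outputs \<kappa>. entry \<kappa> x s) = 1)"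

definition blackwell_le :: "('s, 'x) channel \<Rightarrow> ('s, 'y) channel \<Rightarrow> bool"  (infix \<open>\<preceq>\<^sub>B\<close> 50) where
  "\<kappa>\<^sub>1 \<preceq>\<^sub>B \<kappa>\<^sub>2 \<longleftrightarrow>
     inputs \<kappa>\<^sub>1 = inputs \<kappa>\<^sub>2 \<and>
     (\<exists>\<Lambda> :: ('y, 'x) channel.
        stochastic \<Lambda> \<and> inputs \<Lambda> = outputs \<kappa>\<^sub>2 \<and> outputs \<Lambda> = outputs \<kappa>\<^sub>1 \<and>
        (\<forall>x\<in>outputs \<kappa>\<^sub>1. \<forall>s\<in>inputs \<kappa>\<^sub>1.
           entry \<kappa>\<^sub>1 x s = (\<Sum>y\<in>outputs \<kappa>\<^sub>2. entry \<Lambda> x y * entry \<kappa>\<^sub>2 y s)))"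

definition blackwell_less :: "('s, 'x) channel \<Rightarrow> ('s, 'y) channel \<Rightarrow> bool"  (infix \<open>\<prec>\<^sub>B\<close> 50) where
  "\<kappa>\<^sub>1 \<prec>\<^sub>B \<kappa>\<^sub>2 \<longleftrightarrow> \<kappa>\<^sub>1 \<preceq>\<^sub>B \<kappa>\<^sub>2 \<and> \<not> \<kappa>\<^sub>2 \<preceq>\<^sub>B \<kappa>\<^sub>1"

definition finite_rv :: "'w measure \<Rightarrow> 'a set \<Rightarrow> ('w \<Rightarrow> 'a) \<Rightarrow> bool" where
  "finite_rv M A X \<longleftrightarrow> finite A \<and> X \<in> measurable M (count_space A)"

definition rv_support :: "'w measure \<Rightarrow> ('w \<Rightarrow> 'a) \<Rightarrow> 'a set" where
  "rv_support M T = {t. \<P>(\<omega> in M. T \<omega> = t) > 0}"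

text \<open>The channel \<open>X \<leftarrow> T\<close>, where \<open>A\<close> is the alphabet of \<open>X\<close>.\<close>

definition rv_channel :: "'w measure \<Rightarrow> 'x set \<Rightarrow> ('w \<Rightarrow> 'x) \<Rightarrow> ('w \<Rightarrow> 't) \<Rightarrow> ('t, 'x) channel" where
  "rv_channel M A X T =
     \<lparr>inputs = rv_support M T, outputs = A,
      entry = (\<lambda>x t. \<P>(\<omega> in M. X \<omega> = x \<bar> T \<omega> = t))\<rparr>"

definition cond_indep_given :: "'w measure \<Rightarrow> ('w \<Rightarrow> 'a) \<Rightarrow> ('w \<Rightarrow> 'b) \<Rightarrow> ('w \<Rightarrow> 'c) \<Rightarrow> bool" where
  "cond_indep_given M X Y Z \<longleftrightarrow>
     (\<forall>z\<in>rv_support M Z. \<forall>x y.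
        \<P>(\<omega> in M. X \<omega> = x \<and> Y \<omega> = y \<bar> Z \<omega> = z) =
        \<P>(\<omega> in M. X \<omega> = x \<bar> Z \<omega> = z) * \<P>(\<omega> in M. Y \<omega> = y \<bar> Z \<omega> = z))"

lemma finite_rv_support:
  assumes "finite_rv M A T"
  shows "finite (rv_support M T)"
proof (rule finite_subset)
  show "rv_support M T \<subseteq> A"
  proof
    fix t assume "t \<in> rv_support M T"
    then have "{\<omega> \<in> space M. T \<omega> = t} \<noteq> {}"
      unfolding rv_support_def by (metis (mono_tags, lifting) mem_Collect_eq less_irrefl measure_empty)
    then show "t \<in> A"
      using assms by (auto simp: finite_rv_def dest: measurable_space)
  qed
  show "finite A" using assms by (simp add: finite_rv_def)
qed

lemma stochastic_rv_channel:
  assumes "prob_space M" and X: "finite_rv M A X"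
    and T: "T \<in> measurable M (count_space UNIV)" and fin: "finite (rv_support M T)"
  shows "stochastic (rv_channel M A X T)"
proof -
  interpret prob_space M by fact
  have XA: "finite A" and mX: "X \<in> measurable M (count_space A)"
    using X by (auto simp: finite_rv_def)
  have sT: "{\<omega> \<in> space M. T \<omega> = t} \<in> events" for t
    using measurable_sets[OF T, of "{t}"] by (simp add: vimage_def Int_def conj_commute)
  have sX: "{\<omega> \<in> space M. X \<omega> = x} \<in> events" if "x \<in> A" for x
    using measurable_sets[OF mX, of "{x}"] that by (simp add: vimage_def Int_def conj_commute)
  have sXT: "{\<omega> \<in> space M. X \<omega> = x \<and> T \<omega> = t} \<in> events" if "x \<in> A" for x t
  proof -
    have "{\<omega> \<in> space M. X \<omega> = x \<and> T \<omega> = t} =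
        {\<omega> \<in> space M. X \<omega> = x} \<inter> {\<omega> \<in> space M. T \<omega> = t}"
      by auto
    then show ?thesis using sT sX[OF that] by auto
  qed
  have sum1: "(\<Sum>x\<in>A. \<P>(\<omega> in M. X \<omega> = x \<bar> T \<omega> = t)) = 1"
    if t: "t \<in> rv_support M T" for t
  proof -
    have "(\<Sum>x\<in>A. \<P>(\<omega> in M. X \<omega> = x \<and> T \<omega> = t)) =
        prob (\<Union>x\<in>A. {\<omega> \<in> space M. X \<omega> = x \<and> T \<omega> = t})"
      by (rule finite_measure_finite_Union[symmetric])
         (use XA sXT in \<open>auto simp: disjoint_family_on_def\<close>)
    also have "(\<Union>x\<in>A. {\<omega> \<in> space M. X \<omega> = x \<and> T \<omega> = t}) = {\<omega> \<in> space M. T \<omega> = t}"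
      using measurable_space[OF mX] by auto
    finally have "(\<Sum>x\<in>A. \<P>(\<omega> in M. X \<omega> = x \<and> T \<omega> = t)) = \<P>(\<omega> in M. T \<omega> = t)" .
    then show ?thesis
      using t by (simp add: cond_prob_def rv_support_def flip: sum_divide_distrib)
  qed
  show ?thesis
    using fin XA sum1 by (simp add: stochastic_def rv_channel_def cond_prob_def)
qed

end

theory Submission imports Defs begin

text \<open>
  Let \<open>f\<close> merge the values \<open>0\<close> and \<open>1\<close> of \<open>S \<in> {0, 1, 2}\<close>, and let \<open>X\<^sub>2\<close> only reveal whether
  \<open>S = 0\<close>. Then \<open>X\<^sub>2\<close> carries information about \<open>f(S)\<close>, but cannot tell \<open>S = 1\<close> from \<open>S = 2\<close>. Any
  garbling of \<open>X\<^sub>2 \<leftarrow> S\<close> has equal columns at \<open>1\<close> and \<open>2\<close>, whereas \<open>X\<^sub>1\<close>, a noisy version of \<open>f(S)\<close>,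
  has different ones.
\<close>

text \<open>A sum of indicators, unlike a cardinality, unfolds point by point for a concrete
  \<open>n\<close>, so the simplifier can evaluate probabilities.\<close>

lemma prob_uniform_count_measure_lessThan:
  "\<P>(\<omega> in uniform_count_measure {..<n::nat}. P \<omega>) = (\<Sum>\<omega><n. of_bool (P \<omega>)) / real n"
proof -
  have "{\<omega> \<in> space (uniform_count_measure {..<n}). P \<omega>} = {\<omega> \<in> {..<n}. P \<omega>}"
    by (simp add: space_uniform_count_measure)
  moreover have "measure (uniform_count_measure {..<n}) {\<omega> \<in> {..<n}. P \<omega>}
      = card {\<omega> \<in> {..<n}. P \<omega>} / real n"
    by (subst measure_uniform_count_measure) auto
  moreover have "real (card {\<omega> \<in> {..<n}. P \<omega>}) = (\<Sum>\<omega><n. of_bool (P \<omega>))"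
    by (simp add: sum.If_cases of_bool_def Int_def)
  ultimately show ?thesis by simp
qed

text \<open>Garbling multiplies from the left, so each column of the result depends only on the same
  column of the garbled channel. This serves as an obstruction to being a garbling.\<close>

lemma blackwell_le_columns_eq:
  assumes "\<kappa>\<^sub>1 \<preceq>\<^sub>B \<kappa>\<^sub>2" "s \<in> inputs \<kappa>\<^sub>1" "t \<in> inputs \<kappa>\<^sub>1" "x \<in> outputs \<kappa>\<^sub>1"
    and "\<And>y. y \<in> outputs \<kappa>\<^sub>2 \<Longrightarrow> entry \<kappa>\<^sub>2 y s = entry \<kappa>\<^sub>2 y t"
  shows "entry \<kappa>\<^sub>1 x s = entry \<kappa>\<^sub>1 x t"
  using assms unfolding blackwell_le_def by (auto intro!: sum.cong)

theorem proposition2: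
  "\<exists>(M :: nat measure) (S :: nat \<Rightarrow> nat) (X\<^sub>1 :: nat \<Rightarrow> nat) (X\<^sub>2 :: nat \<Rightarrow> nat)
      (A :: nat set) (A\<^sub>1 :: nat set) (A\<^sub>2 :: nat set) (A' :: nat set) (f :: nat \<Rightarrow> nat).
     prob_space M \<and>
     finite_rv M A S \<and> finite_rv M A\<^sub>1 X\<^sub>1 \<and> finite_rv M A\<^sub>2 X\<^sub>2 \<and>
     finite A' \<and> f \<in> rv_support M S \<rightarrow> A' \<and>
     cond_indep_given M S X\<^sub>1 (f \<circ> S) \<and>
     rv_channel M A\<^sub>1 X\<^sub>1 (f \<circ> S) \<prec>\<^sub>B rv_channel M A\<^sub>2 X\<^sub>2 (f \<circ> S) \<and>
     \<not> rv_channel M A\<^sub>1 X\<^sub>1 S \<preceq>\<^sub>B rv_channel M A\<^sub>2 X\<^sub>2 S"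
proof -
  \<comment> \<open>Seven equally likely points, in blocks of 4, 2 and 1 on which \<open>S\<close>
    is 0, 1 and 2.\<close>
  define M where "M = uniform_count_measure {..<7::nat}"
  define S :: "nat \<Rightarrow> nat" where "S = (\<lambda>\<omega>. if \<omega> < 4 then 0 else if \<omega> < 6 then 1 else 2)"
  \<comment> \<open>The first two blocks have even size, so parity makes \<open>X1\<close> a fair
    coin on each; this yields conditional independence given \<open>f \<circ> S\<close>. On the last
    block \<open>X1\<close> is 1.\<close>
  define X1 :: "nat \<Rightarrow> nat" where "X1 = (\<lambda>\<omega>. if even \<omega> \<and> \<omega> < 6 then 0 else 1)"
  define X2 :: "nat \<Rightarrow> nat" where "X2 = (\<lambda>\<omega>. if \<omega> < 4 then 0 else 1)"
  define f :: "nat \<Rightarrow> nat" where "f = (\<lambda>s. if s = 2 then 1 else 0)"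
  have prob: "\<P>(\<omega> in M. P \<omega>) = (of_bool (P 0) + of_bool (P 1) + of_bool (P 2) + of_bool (P 3)
      + of_bool (P 4) + of_bool (P 5) + of_bool (P 6)) / 7" for P
    unfolding M_def prob_uniform_count_measure_lessThan
    \<comment> \<open>\<open>sum_of_bool_eq\<close> would fold the sum back into a
      cardinality.\<close>
    by (simp add: lessThan_nat_numeral lessThan_Suc del: sum_of_bool_eq)
  note defs = S_def X1_def X2_def f_def
  note compute = cond_prob_def prob defs
  have ps: "prob_space M"
    unfolding M_def by (rule prob_space_uniform_count_measure) (simp_all add: lessThan_empty_iff)
  have rv: "finite_rv M B X" if "finite B" "\<And>\<omega>. X \<omega> \<in> B" for B and X :: "nat \<Rightarrow> nat"
    using that by (auto simp: finite_rv_def M_def measurable_def sets_uniform_count_measure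
        space_uniform_count_measure)
  have suppS: "rv_support M S = {0,1,2}"
    by (auto simp: rv_support_def compute split: if_splits)
  have suppfS: "rv_support M (f \<circ> S) = {0,1}"
    by (auto simp: rv_support_def compute split: if_splits)
  have ci: "cond_indep_given M S X1 (f \<circ> S)"
    unfolding cond_indep_given_def suppfS by (auto simp: compute)
  have le: "rv_channel M {0,1} X1 (f \<circ> S) \<preceq>\<^sub>B rv_channel M {0,1} X2 (f \<circ> S)"
  proof -
    \<comment> \<open>Given \<open>f(S) = 0\<close>, the value 0 has probability 2/3 for
      \<open>X2\<close> and 1/2 for \<open>X1\<close>, hence 3/4 = (1/2)/(2/3). Given
      \<open>f(S) = 1\<close>, both variables are surely 1.\<close>
    define L :: "(nat, nat) channel" where "L = \<lparr>inputs = {0,1}, outputs = {0,1},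
      entry = (\<lambda>x y. if y = 0 then (if x = 0 then 3/4 else 1/4) else of_bool (x = 1))\<rparr>"
    have "stochastic L"
      by (auto simp: stochastic_def L_def)
    then show ?thesis
      unfolding blackwell_le_def
      by (intro conjI exI[of _ L]) (auto simp: L_def rv_channel_def suppfS compute)
  qed
  have not_ge: "\<not> rv_channel M {0,1} X2 (f \<circ> S) \<preceq>\<^sub>B rv_channel M {0,1} X1 (f \<circ> S)"
  proof
    assume "rv_channel M {0,1} X2 (f \<circ> S) \<preceq>\<^sub>B rv_channel M {0,1} X1 (f \<circ> S)"
    then obtain L :: "(nat, nat) channel" where L: "stochastic L" "inputs L = {0,1}" "outputs L = {0,1}"
      and eq: "\<And>x t. x \<in> {0,1} \<Longrightarrow> t \<in> {0,1} \<Longrightarrow> \<P>(\<omega> in M. X2 \<omega> = x \<bar> (f \<circ> S) \<omega> = t)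
        = (\<Sum>y\<in>{0,1}. entry L x y * \<P>(\<omega> in M. X1 \<omega> = y \<bar> (f \<circ> S) \<omega> = t))"
      by (auto simp: blackwell_le_def rv_channel_def suppfS)
    \<comment> \<open>The column at 1 forces this entry to vanish; the column at 0 then needs
      \<open>entry L 0 0\<close> = 4/3, which exceeds 1.\<close>
    have "entry L 0 1 = 0"
      using eq[of 0 1] by (simp add: compute)
    moreover have "2/3 = (entry L 0 0 + entry L 0 1) / 2"
      using eq[of 0 0] by (simp add: compute)
    moreover have "entry L 0 0 \<le> 1"
      using L by (auto simp: stochastic_def)
    ultimately show False by simp
  qed
  have nle: "\<not> rv_channel M {0,1} X1 S \<preceq>\<^sub>B rv_channel M {0,1} X2 S"
  proof
    assume "rv_channel M {0,1} X1 S \<preceq>\<^sub>B rv_channel M {0,1} X2 S"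
    then have "entry (rv_channel M {0,1} X1 S) 0 1 = entry (rv_channel M {0,1} X1 S) 0 2"
      by (rule blackwell_le_columns_eq) (simp_all add: rv_channel_def suppS, auto simp: compute)
    \<comment> \<open>The two entries are 1/2 and 0.\<close>
    then show False
      by (simp add: rv_channel_def compute)
  qed
  have rvs: "finite_rv M {0,1,2} S" "finite_rv M {0,1} X1" "finite_rv M {0,1} X2"
    by (auto intro!: rv simp: defs split: if_splits)
  have "f \<in> rv_support M S \<rightarrow> {0,1}"
    by (auto simp: f_def)
  then show ?thesis
    using ps rvs ci le not_ge nle unfolding blackwell_less_def by blast
qed

end
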